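(* Let $k_1,\dots,k_r\ge1$ be integers and let $$M = S^{k_1}\times S^{k_2}\times\cdots\times S^{k_r}$$ be the product of $k_i$-dimensional spheres. Then the Lyusternik–Shnirelman category of $M$ is one more than the number $r$ of factors: $$\mathrm{cat}\, M = r+1.$$
   Context: The Lyusternik–Shnirelman category $\mathrm{cat}\,M$ is taken in its non-normalized form: it is the minimal number $k$ of closed subsets $A_1,\dots,A_k$ of $M$ covering $M$, each of which is contractible within $M$ to a point (i.e. the inclusion $A_i\hookrightarrow M$ is homotopic to a constant map). *)

theory Defs
  imports "HOL-Analysis.Analysis" "HOL-Library.Extended_Nat"
begin

definition contractible_within :: "'a topology \<Rightarrow> 'a set \<Rightarrow> bool" where
  "contractible_within X A \<longleftrightarrow>
     (\<exists>c\<in>topspace X. homotopic_with (\<lambda>_. True) (subtopology X A) X id (\<lambda>_. c))"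

(* Non-normalized Lyusternik--Shnirelman category (a nonempty contractible space has category 1).
   It is infinite if no finite cover of the required kind exists. The sets need not be distinct
   or nonempty, which does not affect the minimum. *)
definition ls_cat :: "'a topology \<Rightarrow> enat" where
  "ls_cat X = Inf {enat n | n. \<exists>A :: nat \<Rightarrow> 'a set.
      (\<forall>i\<in>{1..n}. closedin X (A i) \<and> contractible_within X (A i)) \<and>
      (\<Union>i\<in>{1..n}. A i) = topspace X}"

end

theory Submission
  imports Defs "HOL-Homology.Brouwer_Degree"
begin

text \<open>
  \<^bold>\<open>Upper bound.\<close> Choose \<open>r + 1\<close> disjoint nonempty open bands in each sphere and let \<open>A j\<close> consist of the
  points of the product none of whose \<open>r\<close> coordinates lies in the \<open>j\<close>-th band of its sphere. By the
  pigeonhole principle these closed sets cover. Each of them is a product of proper subsets of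
  spheres; a proper subset of a sphere can be pushed to a point within the sphere
  (\<open>inclusion_sphere_nullhomotopic\<close>), and doing this in every coordinate contracts \<open>A j\<close>.

  \<^bold>\<open>Lower bound.\<close> Suppose that at most \<open>r\<close> closed sets \<open>A i\<close>, each contractible in the product \<open>M\<close>, cover
  it. The projection of \<open>A i\<close> to the \<open>i\<close>-th sphere is null-homotopic; by homotopy extension
  (\<open>homotopy_extension_sphere\<close>) the \<open>i\<close>-th projection of \<open>M\<close> is homotopic to a map that is constant on
  \<open>A i\<close>, with a value that may be taken to be the south pole because the sphere is path connected.
  Together these maps form a self-map of \<open>M\<close> homotopic to the identity, and since the sets cover, each of
  its values has a south pole among its coordinates. So the point \<open>d\<close> whose
  coordinates are all north poles is not attained.

  That this is impossible is \<open>homotopic_id_attains_poles\<close>. Cohomology is avoided by placing \<open>M\<close> in a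
  Euclidean space of one dimension more, as the boundary of a solid body: rotating a body that lies in
  a half space multiplies its boundary by a sphere, and a translation moves the new body into a half
  space again (\<open>tube_fold\<close>, \<open>tube_shift\<close>, \<open>tube_exists\<close>). The construction keeps track of a ray that starts
  at an interior point \<open>a\<close> and crosses the boundary only at \<open>d\<close>. A deformation of \<open>M\<close> off \<open>d\<close> would allow
  the boundary to escape backwards along this ray and to contract without meeting \<open>a\<close>
  (\<open>tube_nullhomotopic_avoiding\<close>). Filling the body by that null-homotopy would map Euclidean space
  into the complement of \<open>a\<close> by a map that is the identity far out, and would thereby contract a sphere
  (\<open>tube_not_nullhomotopic\<close>).
\<close>

section \<open>Spheres and products as sets of sequences\<close>

abbreviation homotopic_maps :: "'a::topological_space set \<Rightarrow> 'b::topological_space set \<Rightarrow> ('a \<Rightarrow> 'b) \<Rightarrow> ('a \<Rightarrow> 'b) \<Rightarrow> bool"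
  where "homotopic_maps S T f g \<equiv> homotopic_with_canon (\<lambda>_. True) S T f g"

definition eucl :: "nat \<Rightarrow> (nat \<Rightarrow> real) set"
  where "eucl n = {x. \<forall>i\<ge>n. x i = 0}"

definition unit_sphere :: "nat \<Rightarrow> (nat \<Rightarrow> real) set"
  where "unit_sphere k = {x. (\<Sum>i\<le>k. (x i)\<^sup>2) = 1 \<and> (\<forall>i>k. x i = 0)}"

definition axis_point :: "real \<Rightarrow> nat \<Rightarrow> real"
  where "axis_point t = (\<lambda>i. if i = 0 then t else 0)"

definition head_norm :: "nat \<Rightarrow> (nat \<Rightarrow> real) \<Rightarrow> real"
  where "head_norm k x = sqrt (\<Sum>i\<le>k. (x i)\<^sup>2)"

text \<open>
  The radial projection of the first \<open>k + 1\<close> coordinates to the unit sphere; all later coordinates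
  are dropped, so that the value lies in the sphere for every sequence \<open>x\<close> with a nonzero head.
\<close>

definition direction :: "nat \<Rightarrow> (nat \<Rightarrow> real) \<Rightarrow> nat \<Rightarrow> real"
  where "direction k x = (\<lambda>i. if i \<le> k then x i / head_norm k x else 0)"

lemma nsphere_eq_top_of_set: "nsphere k = top_of_set (unit_sphere k)"
  by (simp add: nsphere unit_sphere_def euclidean_product_topology)

text \<open>
  The abstract product of subspaces lives on extensional functions, so it is the subspace of the full
  function space cut out by fixing the value \<open>undefined\<close> outside \<open>I\<close>. This transports the whole problem
  to topological type classes, where continuity can be checked coordinate by coordinate and where
  compactness and metrizability of the function space are at hand.
\<close>

lemma product_topology_top_of_set:
  fixes S :: "'i \<Rightarrow> 'a::topological_space set"
  shows "product_topology (\<lambda>i. top_of_set (S i)) I = top_of_set (PiE I S)"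
proof -
  have "continuous_map (product_topology (\<lambda>i. top_of_set (S i)) I) (top_of_set (PiE I S)) id"
  proof -
    have "continuous_map (product_topology (\<lambda>i. top_of_set (S i)) I) euclidean (\<lambda>x. x j)" for j
    proof (cases "j \<in> I")
      case True
      then show ?thesis
        using continuous_map_product_coordinates[of j I "\<lambda>i. top_of_set (S i)"]
        by (simp add: continuous_map_in_subtopology)
    next
      case False
      show ?thesis
        by (rule continuous_map_eq[where f = "\<lambda>_. undefined"])
          (use False in \<open>auto simp: PiE_def extensional_def\<close>)
    qed
    then show ?thesis
      by (auto simp: continuous_map_in_subtopology continuous_map_componentwise_UNIV id_def
          simp flip: euclidean_product_topology)
  qed
  moreover have "continuous_map (top_of_set (PiE I S)) (product_topology (\<lambda>i. top_of_set (S i)) I) id"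
  proof -
    have "continuous_on (PiE I S) (\<lambda>x. x j)" for j
      by (rule continuous_on_product_then_coordinatewise) simp
    then show ?thesis
      by (auto simp: continuous_map_componentwise continuous_map_in_subtopology PiE_def)
  qed
  ultimately have "homeomorphic_maps (product_topology (\<lambda>i. top_of_set (S i)) I) (top_of_set (PiE I S)) id id"
    by (simp add: homeomorphic_maps_def)
  then show ?thesis
    by (simp only: homeomorphic_maps_id)
qed

lemma continuous_on_coordinate [continuous_intros]:
  "continuous_on S (\<lambda>x :: 'i \<Rightarrow> 'a::topological_space. x i)"
  by (rule continuous_on_product_then_coordinatewise) simp

lemma homotopic_maps_PiE:
  fixes Y :: "'i \<Rightarrow> 'b::topological_space set"
  assumes "\<And>i. i \<in> I \<Longrightarrow> homotopic_maps X (Y i) (\<lambda>x. f x i) (\<lambda>x. g x i)"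
    and f: "f \<in> X \<rightarrow> extensional I" and g: "g \<in> X \<rightarrow> extensional I"
  shows "homotopic_maps X (PiE I Y) f g"
proof -
  obtain h where h: "\<And>i. i \<in> I \<Longrightarrow> continuous_on ({0..1::real} \<times> X) (h i) \<and> h i \<in> ({0..1} \<times> X) \<rightarrow> Y i \<and>
     (\<forall>x. h i (0, x) = f x i) \<and> (\<forall>x. h i (1, x) = g x i)"
    using assms(1) unfolding homotopic_with_def by simp metis
  show ?thesis
  proof (subst homotopic_with, simp, intro exI[of _ "\<lambda>z. (\<lambda>i\<in>I. h i z)"] conjI)
    have "continuous_on ({0..1} \<times> X) (\<lambda>z. \<lambda>i\<in>I. h i z)"
    proof (rule continuous_on_coordinatewise_then_product)
      show "continuous_on ({0..1} \<times> X) (\<lambda>x. (\<lambda>i\<in>I. h i x) i)" for i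
        using h by (cases "i \<in> I") auto
    qed
    then show "continuous_map (prod_topology (top_of_set {0..1}) (top_of_set X)) (top_of_set (PiE I Y))
       (\<lambda>z. \<lambda>i\<in>I. h i z)"
      using h by (auto simp: Pi_iff)
  qed (use h f g in \<open>auto simp: fun_eq_iff Pi_iff extensional_def\<close>)
qed

lemma homotopic_mapsI:
  assumes "continuous_on ({0..1::real} \<times> S) h" "\<And>t x. 0 \<le> t \<Longrightarrow> t \<le> 1 \<Longrightarrow> x \<in> S \<Longrightarrow> h (t, x) \<in> T"
    "\<And>x. x \<in> S \<Longrightarrow> h (0, x) = f x" "\<And>x. x \<in> S \<Longrightarrow> h (1, x) = g x"
  shows "homotopic_maps S T f g"
  using assms by (subst homotopic_with) (auto intro!: exI[of _ h])

lemma head_norm_nonneg [simp]: "0 \<le> head_norm k x"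
  by (simp add: head_norm_def sum_nonneg)

lemma head_norm_eq_0: "head_norm k x = 0 \<longleftrightarrow> (\<forall>i\<le>k. x i = 0)"
  by (auto simp: head_norm_def sum_nonneg_eq_0_iff)

lemma head_norm_sphere: "u \<in> unit_sphere k \<Longrightarrow> head_norm k u = 1"
  by (simp add: unit_sphere_def head_norm_def)

lemma head_norm_scale: "head_norm k (\<lambda>i. c * x i) = \<bar>c\<bar> * head_norm k x"
  by (simp add: head_norm_def power_mult_distrib real_sqrt_mult flip: sum_distrib_left)

lemma head_norm_axis [simp]: "head_norm k (axis_point t) = \<bar>t\<bar>"
proof -
  have "(\<Sum>i\<le>k. (axis_point t i)\<^sup>2) = (\<Sum>i\<in>{0}. (axis_point t i)\<^sup>2)"
    by (rule sum.mono_neutral_right) (auto simp: axis_point_def)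
  then show ?thesis by (simp add: head_norm_def axis_point_def)
qed

lemma head_norm_cong: "(\<And>i. i \<le> k \<Longrightarrow> x i = y i) \<Longrightarrow> head_norm k x = head_norm k y"
  by (simp add: head_norm_def)

lemma continuous_on_head_norm [continuous_intros]:
  "continuous_on S f \<Longrightarrow> continuous_on S (\<lambda>x. head_norm k (f x))"
  unfolding head_norm_def
  by (intro continuous_intros) (rule continuous_on_product_then_coordinatewise)

lemma direction_in_sphere: "head_norm k x \<noteq> 0 \<Longrightarrow> direction k x \<in> unit_sphere k"
  unfolding unit_sphere_def direction_def
  by (simp add: power_divide flip: sum_divide_distrib)
    (simp add: head_norm_def sum_nonneg sum_nonneg_eq_0_iff)

lemma continuous_on_direction [continuous_intros]:
  assumes "continuous_on S f" "\<And>x. x \<in> S \<Longrightarrow> head_norm k (f x) \<noteq> 0"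
  shows "continuous_on S (\<lambda>x. direction k (f x))"
proof (rule continuous_on_coordinatewise_then_product)
  show "continuous_on S (\<lambda>x. direction k (f x) i)" for i
    using continuous_on_divide[OF continuous_on_product_then_coordinatewise[OF assms(1)]
        continuous_on_head_norm[OF assms(1)], of k i] assms(2)
    by (cases "i \<le> k") (simp_all add: direction_def)
qed

lemma direction_scale:
  assumes "u \<in> unit_sphere k" "0 < c"
  shows "direction k (\<lambda>i. c * u i) = u"
  using assms by (auto simp: direction_def head_norm_scale head_norm_sphere fun_eq_iff unit_sphere_def)

lemma eucl_eqI: "\<lbrakk>x \<in> eucl (Suc k); \<And>i. i \<le> k \<Longrightarrow> x i = y i; y \<in> eucl (Suc k)\<rbrakk> \<Longrightarrow> x = y"
  by (auto simp: eucl_def fun_eq_iff) (metis not_less_eq_eq)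

lemma unit_sphere_subset_eucl: "unit_sphere k \<subseteq> eucl (Suc k)"
  by (auto simp: unit_sphere_def eucl_def)

lemma unit_sphere_uminus: "u \<in> unit_sphere k \<Longrightarrow> (\<lambda>i. - u i) \<in> unit_sphere k"
  by (simp add: unit_sphere_def)

lemma axis_point_in_sphere: "axis_point 1 \<in> unit_sphere k"
  using head_norm_axis[of k 1] by (auto simp: head_norm_def unit_sphere_def axis_point_def)

section \<open>Homotopies of maps into a sphere\<close>

text \<open>
  The segment joining two non-antipodal unit vectors avoids the origin, so the straight-line homotopy
  can be projected radially back to the sphere.
\<close>

lemma homotopic_maps_sphere_non_antipodal:
  assumes f: "continuous_on S f" "f \<in> S \<rightarrow> unit_sphere k"
    and g: "continuous_on S g" "g \<in> S \<rightarrow> unit_sphere k"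
    and neq: "\<And>x. x \<in> S \<Longrightarrow> f x \<noteq> (\<lambda>i. - g x i)"
  shows "homotopic_maps S (unit_sphere k) f g"
proof -
  have fs: "f x \<in> unit_sphere k" and gs: "g x \<in> unit_sphere k" if "x \<in> S" for x
    using that f g by auto
  define l where "l = (\<lambda>(t::real, x) i. (1 - t) * f x i + t * g x i)"
  have nz: "head_norm k (l (t, x)) \<noteq> 0" if t: "0 \<le> t" "t \<le> 1" and x: "x \<in> S" for t x
  proof
    assume "head_norm k (l (t, x)) = 0"
    then have eq: "(1 - t) * f x i = (- t) * g x i" if "i \<le> k" for i
      using that by (auto simp: head_norm_eq_0 l_def algebra_simps)
    then have "head_norm k (\<lambda>i. (1 - t) * f x i) = head_norm k (\<lambda>i. (- t) * g x i)"
      by (rule head_norm_cong)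
    \<comment> \<open>A zero on the segment forces the two unit vectors to be weighted equally.\<close>
    then have "1 - t = t"
      unfolding head_norm_scale using t head_norm_sphere[OF fs[OF x]] head_norm_sphere[OF gs[OF x]] by simp
    then have "t = 1/2" by simp
    have "f x = (\<lambda>i. - g x i)"
    proof (rule eucl_eqI)
      show "f x \<in> eucl (Suc k)" "(\<lambda>i. - g x i) \<in> eucl (Suc k)"
        using fs[OF x] unit_sphere_uminus[OF gs[OF x]] unit_sphere_subset_eucl by blast+
      show "f x i = - g x i" if "i \<le> k" for i
        using eq[OF that] \<open>t = 1/2\<close> by simp
    qed
    then show False using neq[OF x] by simp
  qed
  have cl: "continuous_on ({0..1} \<times> S) l"
    unfolding l_def case_prod_unfold
    by (intro continuous_on_coordinatewise_then_product continuous_intros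
        continuous_on_compose2[OF continuous_on_product_then_coordinatewise[OF f(1)]]
        continuous_on_compose2[OF continuous_on_product_then_coordinatewise[OF g(1)]]) auto
  show ?thesis
  proof (rule homotopic_mapsI)
    show "continuous_on ({0..1} \<times> S) (\<lambda>z. direction k (l z))"
      using nz by (intro continuous_intros cl) auto
    show "direction k (l (t, x)) \<in> unit_sphere k" if "0 \<le> t" "t \<le> 1" "x \<in> S" for t x
      using direction_in_sphere nz that by blast
    show "direction k (l (0, x)) = f x" if "x \<in> S" for x
      using direction_scale[OF fs[OF that], of 1] by (simp add: l_def)
    show "direction k (l (1, x)) = g x" if "x \<in> S" for x
      using direction_scale[OF gs[OF that], of 1] by (simp add: l_def)
  qed
qed

text \<open>
  A subset missing \<open>p\<close> contains no point antipodal to \<open>- p\<close>, so it can be pushed radially to \<open>- p\<close>.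
\<close>

lemma inclusion_sphere_nullhomotopic:
  assumes "C \<subseteq> unit_sphere k" "p \<in> unit_sphere k" "p \<notin> C"
  shows "homotopic_maps C (unit_sphere k) (\<lambda>x. x) (\<lambda>_. \<lambda>i. - p i)"
proof (rule homotopic_maps_sphere_non_antipodal)
  show "(\<lambda>_. \<lambda>i. - p i) \<in> C \<rightarrow> unit_sphere k"
    using unit_sphere_uminus[OF assms(2)] by simp
  show "x \<noteq> (\<lambda>i. - (- p i))" if "x \<in> C" for x
    using that assms by auto
  show "(\<lambda>x. x) \<in> C \<rightarrow> unit_sphere k"
    using assms(1) by auto
qed (rule continuous_on_id continuous_on_const)+

lemma closed_coordinate_zero: "closed {x::nat \<Rightarrow> real. \<forall>i\<ge>n. x i = 0}"
proof -
  have "{x::nat \<Rightarrow> real. \<forall>i\<ge>n. x i = 0} = (\<Inter>i\<in>{n..}. {x. x i = 0})" by auto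
  then show ?thesis
    by (auto intro!: closed_INT closed_Collect_eq)
qed

lemma compact_unit_sphere: "compact (unit_sphere k)"
proof -
  have "unit_sphere k \<subseteq> PiE UNIV (\<lambda>i. {-1..1})"
  proof
    fix x assume x: "x \<in> unit_sphere k"
    have "(x i)\<^sup>2 \<le> 1" for i
    proof (cases "i \<le> k")
      case True
      then have "(x i)\<^sup>2 \<le> (\<Sum>i\<le>k. (x i)\<^sup>2)"
        by (intro member_le_sum) auto
      then show ?thesis using x by (simp add: unit_sphere_def)
    qed (use x in \<open>auto simp: unit_sphere_def\<close>)
    then show "x \<in> PiE UNIV (\<lambda>i. {-1..1})"
      by (auto simp: abs_square_le_1 abs_le_iff)
  qed
  moreover have "compact (PiE UNIV (\<lambda>i::nat. {-1..1::real}))"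
    using compactin_PiE[of "\<lambda>_. euclidean" "UNIV :: nat set" "\<lambda>i. {-1..1::real}"]
    by (simp add: euclidean_product_topology)
  moreover have "closed (unit_sphere k)"
  proof -
    have "unit_sphere k = {x. (\<Sum>i\<le>k. (x i)\<^sup>2) = 1} \<inter> {x. \<forall>i\<ge>Suc k. x i = 0}"
      by (auto simp: unit_sphere_def Suc_le_eq)
    moreover have "closed {x::nat \<Rightarrow> real. (\<Sum>i\<le>k. (x i)\<^sup>2) = 1}"
      by (intro closed_Collect_eq continuous_intros)
    ultimately show ?thesis using closed_coordinate_zero by auto
  qed
  ultimately show ?thesis
    by (metis compact_Int_closed inf.absorb_iff2)
qed

lemma compact_PiE:
  fixes S :: "'i \<Rightarrow> 'a::topological_space set"
  assumes "\<And>i. i \<in> I \<Longrightarrow> compact (S i)"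
  shows "compact (PiE I S)"
proof -
  have "compact_space (product_topology (\<lambda>i. top_of_set (S i)) I)"
    using assms by (simp add: compact_space_product_topology compact_space_subtopology)
  then show ?thesis
    unfolding product_topology_top_of_set by (simp add: compact_space_def compactin_subtopology)
qed

text \<open>
  The Borsuk homotopy extension property for maps into a sphere. The partial homotopy, defined on the
  bottom of the cylinder and on the part over \<open>A\<close>, is extended by Tietze to the whole cylinder as a map
  into Euclidean space. The points of \<open>U\<close> over which the extension vanishes somewhere form a compact set
  \<open>Z\<close> disjoint from \<open>A\<close>. An Urysohn function \<open>l\<close>, equal to 1 on \<open>A\<close> and to 0 on \<open>Z\<close>, slows the homotopy
  down so that it never reaches a zero, and the result is projected radially to the sphere.
\<close>

lemma homotopy_extension_sphere:
  fixes U :: "'a::{metric_space,second_countable_topology} set"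
  assumes "compact U" and A: "closedin (top_of_set U) A"
    and f: "continuous_on U f" "f \<in> U \<rightarrow> unit_sphere k"
    and hom: "homotopic_maps A (unit_sphere k) f g"
  obtains g' where "homotopic_maps U (unit_sphere k) f g'" "\<And>x. x \<in> A \<Longrightarrow> g' x = g x"
proof -
  obtain h where h: "continuous_on ({0..1::real} \<times> A) h" "h \<in> {0..1} \<times> A \<rightarrow> unit_sphere k"
     "\<And>x. h (0, x) = f x" "\<And>x. h (1, x) = g x"
    using hom unfolding homotopic_with_def by auto
  have AU: "A \<subseteq> U" using A closedin_subset by fastforce
  have "compact A" using A \<open>compact U\<close> by (meson closedin_compact)
  define V where "V = {0..1::real} \<times> U"
  define W0 where "W0 = {0::real} \<times> U"
  define W1 where "W1 = {0..1::real} \<times> A"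
  have cW: "closedin (top_of_set V) (W0 \<union> W1)" "closedin (top_of_set (W0 \<union> W1)) W0" "closedin (top_of_set (W0 \<union> W1)) W1"
    using \<open>compact A\<close> \<open>compact U\<close> AU unfolding V_def W0_def W1_def
    by (auto intro!: closed_subset closed_Un compact_imp_closed compact_Times)
  have WV: "W0 \<union> W1 \<subseteq> V" using AU by (auto simp: V_def W0_def W1_def)
  define w where "w z = (if z \<in> W0 then f (snd z) else h z)" for z
  have cw: "continuous_on (W0 \<union> W1) w"
    unfolding w_def
  proof (rule continuous_on_cases_local[OF cW(2,3)])
    show "continuous_on W0 (\<lambda>z. f (snd z))"
      by (rule continuous_on_compose2[OF f(1)]) (auto simp: W0_def intro!: continuous_intros)
  qed (use h AU in \<open>auto simp: W0_def W1_def\<close>)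
  have ws: "w z \<in> unit_sphere k" if "z \<in> W0 \<union> W1" for z
    using that h(2) f(2) by (auto simp: w_def W0_def W1_def)
  have "\<exists>G. continuous_on V G \<and> (\<forall>z\<in>W0 \<union> W1. G z = w z i)" for i
  proof -
    obtain G where "continuous_on V G" "\<And>z. z \<in> W0 \<union> W1 \<Longrightarrow> G z = w z i"
      using Tietze_unbounded[of "W0 \<union> W1" "\<lambda>z. w z i" V] cw cW(1) by (metis continuous_on_product_then_coordinatewise)
    then show ?thesis by auto
  qed
  then obtain G where G: "\<And>i. continuous_on V (G i)" "\<And>i z. z \<in> W0 \<union> W1 \<Longrightarrow> G i z = w z i"
    by metis
  define T where "T z = (\<lambda>i. G i z)" for z
  have cT: "continuous_on V T"
    unfolding T_def by (intro continuous_on_coordinatewise_then_product G)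
  have Tw: "T z = w z" if "z \<in> W0 \<union> W1" for z
    using G(2)[OF that] by (auto simp: T_def)
  define Z where "Z = snd ` {z \<in> V. head_norm k (T z) = 0}"
  have "closedin (top_of_set V) {z \<in> V. head_norm k (T z) = 0}"
    by (intro continuous_closedin_preimage_constant continuous_intros cT)
  moreover have "compact V" using \<open>compact U\<close> by (auto simp: V_def intro: compact_Times)
  ultimately have "compact {z \<in> V. head_norm k (T z) = 0}"
    by (meson closedin_compact)
  then have "compact Z" unfolding Z_def by (intro compact_continuous_image continuous_intros)
  then have cZ: "closedin (top_of_set U) Z"
    by (intro closed_subset compact_imp_closed) (auto simp: Z_def V_def)
  have ZA: "disjnt Z A"
  proof -
    have "head_norm k (T (t, x)) = 1" if "x \<in> A" "t \<in> {0..1}" for t x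
      using Tw[of "(t, x)"] ws[of "(t, x)"] that head_norm_sphere by (simp add: W1_def)
    then show ?thesis by (fastforce simp: disjnt_iff Z_def V_def)
  qed
  obtain l where l: "continuous_map (top_of_set U) (top_of_set {0..1::real}) l" "l ` Z \<subseteq> {0}" "l ` A \<subseteq> {1}"
    by (rule Urysohn_lemma[OF _ cZ A ZA, of 0 1]) (auto simp: metrizable_imp_normal_space metrizable_space_euclidean metrizable_space_subtopology)
  have cl: "continuous_on U l" and l01: "\<And>x. x \<in> U \<Longrightarrow> 0 \<le> l x \<and> l x \<le> 1"
    using l(1) by (auto simp: Pi_iff)
  define S where "S = (\<lambda>(t::real, x). T (t * l x, x))"
  have SV: "(t * l x, x) \<in> V" if "0 \<le> t" "t \<le> 1" "x \<in> U" for t x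
    using l01[OF that(3)] that by (auto simp: V_def mult_le_one)
  have cS: "continuous_on ({0..1} \<times> U) S"
    unfolding S_def case_prod_unfold
    by (intro continuous_on_compose2[OF cT] continuous_intros continuous_on_compose2[OF cl])
      (use SV in auto)
  have nz: "head_norm k (S (t, x)) \<noteq> 0" if "0 \<le> t" "t \<le> 1" "x \<in> U" for t x
  proof (cases "x \<in> Z")
    case True
    then have "S (t, x) = w (0, x)"
      using l(2) Tw[of "(0, x)"] that by (auto simp: S_def W0_def)
    then show ?thesis
      using ws[of "(0, x)"] head_norm_sphere[of "w (0, x)" k] that by (simp add: W0_def)
  next
    case False
    then show ?thesis using SV[OF that] by (force simp: Z_def S_def)
  qed
  show thesis
  proof
    show "homotopic_maps U (unit_sphere k) f (\<lambda>x. direction k (S (1, x)))"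
    proof (rule homotopic_mapsI)
      show "continuous_on ({0..1} \<times> U) (\<lambda>z. direction k (S z))"
        using nz by (intro continuous_intros cS) auto
      show "direction k (S (t, x)) \<in> unit_sphere k" if "0 \<le> t" "t \<le> 1" "x \<in> U" for t x
        using direction_in_sphere nz that by blast
      show "direction k (S (0, x)) = f x" if "x \<in> U" for x
      proof -
        have "S (0, x) = f x"
          using Tw[of "(0, x)"] that by (auto simp: S_def W0_def w_def)
        then show ?thesis using direction_scale[of "f x" k 1] f that by auto
      qed
    qed auto
    show "direction k (S (1, x)) = g x" if "x \<in> A" for x
    proof -
      have "S (1, x) = h (1, x)"
        using Tw[of "(1, x)"] that l(3) by (auto simp: S_def W0_def W1_def w_def)
      moreover have "h (1, x) \<in> unit_sphere k" using h(2) that by auto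
      ultimately show ?thesis using direction_scale[of "h (1, x)" k 1] h(4) by simp
    qed
  qed
qed

section \<open>Folding a block of coordinates into its norm\<close>

definition fold_head :: "nat \<Rightarrow> (nat \<Rightarrow> real) \<Rightarrow> nat \<Rightarrow> real"
  where "fold_head k z = (\<lambda>j. if j = 0 then head_norm k z else z (k + j))"

definition unfold_head :: "nat \<Rightarrow> (nat \<Rightarrow> real) \<Rightarrow> (nat \<Rightarrow> real) \<Rightarrow> nat \<Rightarrow> real"
  where "unfold_head k x u = (\<lambda>i. if i \<le> k then x 0 * u i else x (i - k))"

text \<open>
  \<open>fold_head\<close> collapses the first \<open>k + 1\<close> coordinates to their norm, and \<open>direction\<close> records what is lost.
  Together they are polar coordinates in the head: away from a vanishing head they identify
  \<open>\<real>\<^sup>k\<^sup>+\<^sup>n\<close> with the product of a \<open>k\<close>-sphere and the half space where coordinate 0 is positive;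
  \<open>unfold_head\<close> is the inverse.
\<close>

lemma unfold_fold: "head_norm k z \<noteq> 0 \<Longrightarrow> unfold_head k (fold_head k z) (direction k z) = z"
  by (auto simp: unfold_head_def fold_head_def direction_def fun_eq_iff)

lemma fold_unfold: "\<lbrakk>u \<in> unit_sphere k; 0 \<le> x 0\<rbrakk> \<Longrightarrow> fold_head k (unfold_head k x u) = x"
proof -
  assume u: "u \<in> unit_sphere k" and x: "0 \<le> x 0"
  have "head_norm k (unfold_head k x u) = head_norm k (\<lambda>i. x 0 * u i)"
    by (rule head_norm_cong) (simp add: unfold_head_def)
  then have "head_norm k (unfold_head k x u) = x 0"
    using u x by (simp add: head_norm_scale head_norm_sphere)
  then show ?thesis
    by (auto simp: fold_head_def unfold_head_def fun_eq_iff)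
qed

lemma axis_point_0 [simp]: "axis_point t 0 = t"
  by (simp add: axis_point_def)

lemma fold_axis_point: "0 \<le> t \<Longrightarrow> fold_head k (axis_point t) = axis_point t"
  unfolding fold_head_def head_norm_axis by (auto simp: axis_point_def)

lemma fold_in_eucl: "\<lbrakk>z \<in> eucl (k + n); 0 < n\<rbrakk> \<Longrightarrow> fold_head k z \<in> eucl n"
  by (auto simp: eucl_def fold_head_def)

lemma unfold_in_eucl: "\<lbrakk>x \<in> eucl n; 0 < n\<rbrakk> \<Longrightarrow> unfold_head k x u \<in> eucl (k + n)"
  by (auto simp: eucl_def unfold_head_def)

lemma axis_point_in_eucl: "0 < n \<Longrightarrow> axis_point t \<in> eucl n"
  by (auto simp: eucl_def axis_point_def)

lemma sum_squares_fold:
  assumes "0 < n"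
  shows "(\<Sum>i<n. (fold_head k z i)\<^sup>2) = (\<Sum>i<k + n. (z i)\<^sup>2)"
proof -
  obtain m where n: "n = Suc m" using assms gr0_implies_Suc by blast
  have "(\<Sum>i<n. (fold_head k z i)\<^sup>2) = (head_norm k z)\<^sup>2 + (\<Sum>i<m. (z (Suc k + i))\<^sup>2)"
    unfolding n by (subst sum.lessThan_Suc_shift) (simp add: fold_head_def)
  also have "(head_norm k z)\<^sup>2 = (\<Sum>i<Suc k. (z i)\<^sup>2)"
    by (simp add: head_norm_def sum_nonneg lessThan_Suc_atMost)
  also have "(\<Sum>i<Suc k. (z i)\<^sup>2) + (\<Sum>i<m. (z (Suc k + i))\<^sup>2) = (\<Sum>i<Suc k + m. (z i)\<^sup>2)"
    by (induction m) simp_all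
  finally show ?thesis by (simp add: n)
qed

lemma continuous_on_fold:
  assumes "continuous_on S f"
  shows "continuous_on S (\<lambda>x. fold_head k (f x))"
proof (rule continuous_on_coordinatewise_then_product)
  show "continuous_on S (\<lambda>x. fold_head k (f x) j)" for j
    using continuous_on_head_norm[OF assms, of k] continuous_on_product_then_coordinatewise[OF assms]
    by (cases "j = 0") (simp_all add: fold_head_def)
qed

lemma continuous_on_unfold:
  assumes "continuous_on S f" "continuous_on S g"
  shows "continuous_on S (\<lambda>x. unfold_head k (f x) (g x))"
proof (rule continuous_on_coordinatewise_then_product)
  show "continuous_on S (\<lambda>x. unfold_head k (f x) (g x) i)" for i
    using continuous_on_mult[OF continuous_on_product_then_coordinatewise[OF assms(1), of 0]
        continuous_on_product_then_coordinatewise[OF assms(2), of i]]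
      continuous_on_product_then_coordinatewise[OF assms(1), of "i - k"]
    by (cases "i \<le> k") (simp_all add: unfold_head_def)
qed

section \<open>A product of spheres as the boundary of a nested solid torus\<close>

definition half_eucl :: "nat \<Rightarrow> (nat \<Rightarrow> real) set"
  where "half_eucl n = {x \<in> eucl n. 0 \<le> x 0}"

text \<open>
  A \<open>tube\<close> presents \<open>M\<close> as a collared hypersurface in the region \<open>D\<close> of \<open>\<real>\<^sup>n\<close>. The sublevel set
  \<open>\<rho> \<le> 1\<close> is a solid body of squared radius at most \<open>B\<close>, and its boundary, the level set \<open>\<rho> = 1\<close>, is the
  image of \<open>M\<close> under \<open>e\<close>. The map \<open>U\<close> projects the collar \<open>1/2 \<le> \<rho> \<le> 1\<close> to \<open>M\<close>, and \<open>e \<circ> U\<close> fixes the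
  boundary. The last clauses say that the ray along the coordinate axis starting at the interior point
  \<open>axis_point \<alpha>\<close> can meet the boundary only in the image of \<open>d\<close>.
\<close>

definition tube :: "nat \<Rightarrow> 'm::topological_space set \<Rightarrow> 'm \<Rightarrow> (nat \<Rightarrow> real) set \<Rightarrow>
    ((nat \<Rightarrow> real) \<Rightarrow> real) \<Rightarrow> ((nat \<Rightarrow> real) \<Rightarrow> 'm) \<Rightarrow> ('m \<Rightarrow> nat \<Rightarrow> real) \<Rightarrow> real \<Rightarrow> real \<Rightarrow> bool"
  where "tube n M d D \<rho> U e \<alpha> B \<longleftrightarrow>
     continuous_on D \<rho> \<and> (\<forall>z\<in>D. \<rho> z \<le> 1 \<longrightarrow> (\<Sum>i<n. (z i)\<^sup>2) \<le> B) \<and>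
     continuous_on {z \<in> D. 1/2 \<le> \<rho> z \<and> \<rho> z \<le> 1} U \<and> U \<in> {z \<in> D. 1/2 \<le> \<rho> z \<and> \<rho> z \<le> 1} \<rightarrow> M \<and>
     continuous_on M e \<and> e \<in> M \<rightarrow> D \<and> (\<forall>x\<in>M. \<rho> (e x) = 1) \<and> (\<forall>z\<in>D. \<rho> z = 1 \<longrightarrow> e (U z) = z) \<and>
     0 < \<alpha> \<and> axis_point \<alpha> \<in> D \<and> \<rho> (axis_point \<alpha>) < 1/2 \<and> (\<forall>x\<in>M. \<forall>t\<ge>\<alpha>. e x = axis_point t \<longrightarrow> x = d)"

text \<open>
  The starting tube is the unit interval on the half line, bounded by the single point 1.
  The half line, with its boundary at 0, is what makes one boundary point sufficient.
\<close>

lemma tube_point: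
  "tube 1 {d} d (half_eucl 1) (\<lambda>x. x 0) (\<lambda>_. d) (\<lambda>_. axis_point 1) (1/4) 1"
proof -
  have "z = axis_point 1" if "z \<in> half_eucl 1" "z 0 = 1" for z
    using that by (auto simp: half_eucl_def eucl_def axis_point_def fun_eq_iff)
  moreover have "(z 0)\<^sup>2 \<le> 1" if "z \<in> half_eucl 1" "z 0 \<le> 1" for z
    using that by (auto simp: half_eucl_def abs_square_le_1)
  moreover have "axis_point t \<in> half_eucl 1" if "0 \<le> t" for t
    using that by (auto simp: half_eucl_def eucl_def axis_point_def)
  ultimately show ?thesis
    by (auto simp: tube_def intro: continuous_on_coordinate continuous_on_const)
qed

text \<open>
  Rotating a tube that lies in a half space multiplies its boundary by a sphere: a point of the larger
  space belongs to the new body if and only if its image under \<open>fold_head\<close> belongs to the old one.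
  Positivity of coordinate 0 on the collar guarantees that the new spherical coordinate, the direction
  of the head, is continuous there. A point on the positive axis folds to itself and has direction
  \<open>axis_point 1\<close>, so the axis again meets the new boundary only in the distinguished point.
\<close>

lemma tube_fold:
  assumes t: "tube n (PiE {1..r} S) d (half_eucl n) \<rho> U e \<alpha> B" and n: "0 < n"
    and pos: "\<forall>z\<in>half_eucl n. 1/2 \<le> \<rho> z \<and> \<rho> z \<le> 1 \<longrightarrow> 0 < z 0"
    and S: "S (Suc r) = unit_sphere k"
  shows "tube (k + n) (PiE {1..Suc r} S) (d(Suc r := axis_point 1)) (eucl (k + n))
    (\<lambda>z. \<rho> (fold_head k z)) (\<lambda>z. (U (fold_head k z))(Suc r := direction k z))
    (\<lambda>x. unfold_head k (e (restrict x {1..r})) (x (Suc r))) \<alpha> B"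
proof -
  let ?M = "PiE {1..r} S" and ?M' = "PiE {1..Suc r} S"
  let ?C = "{z \<in> half_eucl n. 1/2 \<le> \<rho> z \<and> \<rho> z \<le> 1}"
  let ?C' = "{z \<in> eucl (k + n). 1/2 \<le> \<rho> (fold_head k z) \<and> \<rho> (fold_head k z) \<le> 1}"
  have fold: "fold_head k z \<in> half_eucl n" if "z \<in> eucl (k + n)" for z
    using fold_in_eucl[OF that n] by (auto simp: half_eucl_def) (simp add: fold_head_def)
  have nz: "head_norm k z \<noteq> 0" if "z \<in> ?C'" for z
  proof -
    have "0 < fold_head k z 0" using pos that fold by blast
    then show ?thesis by (simp add: fold_head_def)
  qed
  have res: "restrict x {1..r} \<in> ?M" "x (Suc r) \<in> unit_sphere k" if "x \<in> ?M'" for x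
    using that S by (auto simp: PiE_def Pi_iff)
  have epos: "0 < e x 0" "e x \<in> half_eucl n" "\<rho> (e x) = 1" if "x \<in> ?M" for x
  proof -
    show *: "e x \<in> half_eucl n" "\<rho> (e x) = 1" using t that by (auto simp: tube_def)
    then show "0 < e x 0" using pos by simp
  qed
  have fe: "fold_head k (unfold_head k (e (restrict x {1..r})) (x (Suc r))) = e (restrict x {1..r})"
    if "x \<in> ?M'" for x
    using fold_unfold[of "x (Suc r)" k "e (restrict x {1..r})"] epos(1)[OF res(1)[OF that]] res[OF that] by simp
  have c_res: "continuous_on ?M' (\<lambda>x. restrict x {1..r})"
  proof (rule continuous_on_coordinatewise_then_product)
    show "continuous_on ?M' (\<lambda>x. restrict x {1..r} i)" for i
      by (cases "i \<in> {1..r}") (auto intro: continuous_on_coordinate)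
  qed
  show ?thesis
    unfolding tube_def
  proof (intro conjI ballI impI allI)
    show "continuous_on (eucl (k + n)) (\<lambda>z. \<rho> (fold_head k z))"
      by (rule continuous_on_compose2[of "half_eucl n" \<rho>])
        (use t fold in \<open>auto simp: tube_def intro: continuous_on_fold\<close>)
    show "(\<Sum>i<k + n. (z i)\<^sup>2) \<le> B" if "z \<in> eucl (k + n)" "\<rho> (fold_head k z) \<le> 1" for z
      using t that fold[OF that(1)] sum_squares_fold[OF n, of k z] by (auto simp: tube_def)
    have cUf: "continuous_on ?C' (\<lambda>z. U (fold_head k z))"
      by (rule continuous_on_compose2[of ?C U]) (use t fold in \<open>auto simp: tube_def intro: continuous_on_fold\<close>)
    show "continuous_on ?C' (\<lambda>z. (U (fold_head k z))(Suc r := direction k z))"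
    proof (rule continuous_on_coordinatewise_then_product)
      show "continuous_on ?C' (\<lambda>z. ((U (fold_head k z))(Suc r := direction k z)) i)" for i
        using continuous_on_product_then_coordinatewise[OF cUf, of i]
          continuous_on_direction[OF continuous_on_id, of ?C' k] nz
        by (cases "i = Suc r") auto
    qed
    have UM: "U z \<in> ?M" if "z \<in> ?C" for z
      using t that by (auto simp: tube_def)
    show "(\<lambda>z. (U (fold_head k z))(Suc r := direction k z)) \<in> ?C' \<rightarrow> ?M'"
    proof
      fix z assume z: "z \<in> ?C'"
      have "U (fold_head k z) \<in> ?M" using UM z fold by auto
      moreover have "direction k z \<in> S (Suc r)" using direction_in_sphere nz[OF z] S by auto
      ultimately show "(U (fold_head k z))(Suc r := direction k z) \<in> ?M'"
        by (auto simp: PiE_def Pi_iff extensional_def le_Suc_eq)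
    qed
    show "continuous_on ?M' (\<lambda>x. unfold_head k (e (restrict x {1..r})) (x (Suc r)))"
      by (intro continuous_on_unfold continuous_on_coordinate continuous_on_compose2[OF _ c_res, of ?M e])
        (use t res in \<open>auto simp: tube_def\<close>)
    show "(\<lambda>x. unfold_head k (e (restrict x {1..r})) (x (Suc r))) \<in> ?M' \<rightarrow> eucl (k + n)"
      using epos(2) res(1) unfold_in_eucl[OF _ n] by (auto simp: half_eucl_def)
    show "\<rho> (fold_head k (unfold_head k (e (restrict x {1..r})) (x (Suc r)))) = 1" if "x \<in> ?M'" for x
      using fe[OF that] epos(3) res(1)[OF that] by simp
    show "unfold_head k (e (restrict ((U (fold_head k z))(Suc r := direction k z)) {1..r}))
       (((U (fold_head k z))(Suc r := direction k z)) (Suc r)) = z"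
      if "z \<in> eucl (k + n)" "\<rho> (fold_head k z) = 1" for z
    proof -
      have "U (fold_head k z) \<in> ?M" using UM[of "fold_head k z"] that fold by auto
      then have "restrict ((U (fold_head k z))(Suc r := direction k z)) {1..r} = U (fold_head k z)"
        by (auto simp: fun_eq_iff PiE_def extensional_def)
      moreover have "e (U (fold_head k z)) = fold_head k z"
        using t fold[OF that(1)] that(2) by (auto simp: tube_def)
      ultimately show ?thesis using unfold_fold[of k z] nz[of z] that by simp
    qed
    show "0 < \<alpha>" using t by (simp add: tube_def)
    then show "\<rho> (fold_head k (axis_point \<alpha>)) < 1/2"
      using t fold_axis_point[of \<alpha> k] by (simp add: tube_def)
    show "axis_point \<alpha> \<in> eucl (k + n)" using n axis_point_in_eucl by auto
    show "x = d(Suc r := axis_point 1)"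
      if x: "x \<in> ?M'" and "\<alpha> \<le> t" and eq: "unfold_head k (e (restrict x {1..r})) (x (Suc r)) = axis_point t" for x t
    proof -
      have t0: "0 < t" using \<open>0 < \<alpha>\<close> \<open>\<alpha> \<le> t\<close> by simp
      have ea: "e (restrict x {1..r}) = axis_point t"
        using fe[OF x] fold_axis_point[of t k] t0 unfolding eq by simp
      then have d: "restrict x {1..r} = d"
        using t res(1)[OF x] \<open>\<alpha> \<le> t\<close> by (auto simp: tube_def)
      have "x (Suc r) i = axis_point 1 i" for i
      proof (cases "i \<le> k")
        case True
        then have "t * x (Suc r) i = axis_point t i"
          using fun_cong[OF eq, of i] unfolding ea by (simp add: unfold_head_def axis_point_def)
        then show ?thesis using t0 by (auto simp: axis_point_def split: if_splits)
      next
        case False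
        then show ?thesis using res(2)[OF x] by (auto simp: unit_sphere_def axis_point_def)
      qed
      then have "x (Suc r) = axis_point 1" by auto
      moreover have "x i = d i" if "i \<noteq> Suc r" for i
        using x that fun_cong[OF d, of i] by (cases "i \<in> {1..r}") (auto simp: PiE_def extensional_def)
      ultimately show ?thesis by (auto simp: fun_eq_iff)
    qed
  qed
qed

text \<open>
  A bounded body can be translated along the axis into the open half space; after that it can be rotated
  again by \<open>tube_fold\<close>. The axis is preserved by the translation.
\<close>

lemma tube_shift:
  assumes t: "tube n M d (eucl n) \<rho> U e \<alpha> B" and n: "0 < n"
  obtains \<rho>' U' e' \<alpha>' B' where "tube n M d (half_eucl n) \<rho>' U' e' \<alpha>' B'"
    "\<forall>z\<in>half_eucl n. 1/2 \<le> \<rho>' z \<and> \<rho>' z \<le> 1 \<longrightarrow> 0 < z 0"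
proof -
  \<comment> \<open>In the body coordinate 0 is at least \<open>- \<bar>B\<bar> - 1\<close>, so this shift makes it at least 1.\<close>
  define c where "c = \<bar>B\<bar> + 2"
  define sh where "sh s z = (\<lambda>i. if i = 0 then z 0 + s else z i)" for s :: real and z :: "nat \<Rightarrow> real"
  have sh_eucl: "sh s z \<in> eucl n" if "z \<in> eucl n" for s z
    using that n by (auto simp: eucl_def sh_def)
  have half: "z \<in> eucl n" if "z \<in> half_eucl n" for z
    using that by (auto simp: half_eucl_def)
  have sh_sh [simp]: "sh s (sh s' z) = sh (s + s') z" for s s' z
    by (auto simp: sh_def fun_eq_iff)
  have sh0 [simp]: "sh 0 z = z" for z by (auto simp: sh_def fun_eq_iff)
  have sh_axis: "sh s (axis_point a) = axis_point (a + s)" for s a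
    by (auto simp: sh_def axis_point_def fun_eq_iff)
  have c_sh: "continuous_on S (sh s)" for S s
  proof (rule continuous_on_coordinatewise_then_product)
    show "continuous_on S (\<lambda>x. sh s x i)" for i
      by (cases "i = 0") (auto simp: sh_def intro!: continuous_on_add continuous_on_coordinate continuous_on_const)
  qed
  have sq: "(\<Sum>i<n. (sh s z i)\<^sup>2) = (\<Sum>i<n. (z i)\<^sup>2) + 2 * s * z 0 + s\<^sup>2" for s z
  proof -
    have "(\<Sum>i<n. (sh s z i)\<^sup>2) = (\<Sum>i<n. (z i)\<^sup>2 + (if i = 0 then 2 * s * z 0 + s\<^sup>2 else 0))"
      by (intro sum.cong refl) (auto simp: sh_def power2_sum algebra_simps)
    also have "\<dots> = (\<Sum>i<n. (z i)\<^sup>2) + (2 * s * z 0 + s\<^sup>2)"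
      using n by (simp add: sum.distrib sum.delta)
    finally show ?thesis by simp
  qed
  have bound: "(\<Sum>i<n. (z i)\<^sup>2) \<le> B" "\<bar>z 0\<bar> \<le> \<bar>B\<bar> + 1" if "z \<in> eucl n" "\<rho> z \<le> 1" for z
  proof -
    show *: "(\<Sum>i<n. (z i)\<^sup>2) \<le> B" using t that by (auto simp: tube_def)
    have "(z 0)\<^sup>2 \<le> (\<Sum>i<n. (z i)\<^sup>2)" using n by (intro member_le_sum) auto
    also have "\<dots> \<le> (\<bar>B\<bar> + 1)\<^sup>2" using * by (simp add: power2_sum) (smt (verit) zero_le_power2)
    finally show "\<bar>z 0\<bar> \<le> \<bar>B\<bar> + 1" by (simp add: abs_le_square_iff[symmetric])
  qed
  have large: "1 \<le> z 0" if "z \<in> eucl n" "\<rho> (sh (- c) z) \<le> 1" for z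
    using bound(2)[OF sh_eucl that(2)] that(1) by (auto simp: sh_def c_def)
  show thesis
  proof
    show "\<forall>z\<in>half_eucl n. 1/2 \<le> \<rho> (sh (- c) z) \<and> \<rho> (sh (- c) z) \<le> 1 \<longrightarrow> 0 < z 0"
      using large half by force
    show "tube n M d (half_eucl n) (\<lambda>z. \<rho> (sh (- c) z)) (\<lambda>z. U (sh (- c) z)) (\<lambda>x. sh c (e x)) (\<alpha> + c)
       (B + 2 * c * (\<bar>B\<bar> + 1) + c\<^sup>2)"
      unfolding tube_def
    proof (intro conjI ballI impI allI)
      show "continuous_on (half_eucl n) (\<lambda>z. \<rho> (sh (- c) z))"
        by (rule continuous_on_compose2[of "eucl n" \<rho>])
          (use t sh_eucl half c_sh in \<open>auto simp: tube_def\<close>)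
      show "(\<Sum>i<n. (z i)\<^sup>2) \<le> B + 2 * c * (\<bar>B\<bar> + 1) + c\<^sup>2"
        if "z \<in> half_eucl n" "\<rho> (sh (- c) z) \<le> 1" for z
      proof -
        let ?y = "sh (- c) z"
        have y: "?y \<in> eucl n" using sh_eucl half that(1) by auto
        have "(\<Sum>i<n. (z i)\<^sup>2) = (\<Sum>i<n. (?y i)\<^sup>2) + 2 * c * ?y 0 + c\<^sup>2"
          using sq[of c ?y] by simp
        moreover have "2 * c * ?y 0 \<le> 2 * c * (\<bar>B\<bar> + 1)"
          using bound(2)[OF y that(2)] by (intro mult_left_mono) (auto simp: c_def)
        ultimately show ?thesis using bound(1)[OF y that(2)] by linarith
      qed
      let ?C = "{z \<in> half_eucl n. 1/2 \<le> \<rho> (sh (- c) z) \<and> \<rho> (sh (- c) z) \<le> 1}"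
      show "continuous_on ?C (\<lambda>z. U (sh (- c) z))"
        by (rule continuous_on_compose2[of "{z \<in> eucl n. 1/2 \<le> \<rho> z \<and> \<rho> z \<le> 1}" U])
          (use t sh_eucl half c_sh in \<open>auto simp: tube_def\<close>)
      show "(\<lambda>z. U (sh (- c) z)) \<in> ?C \<rightarrow> M"
        using t sh_eucl half by (auto simp: tube_def Pi_iff)
      show "continuous_on M (\<lambda>x. sh c (e x))"
        by (rule continuous_on_compose2[OF c_sh]) (use t in \<open>auto simp: tube_def\<close>)
      have e: "e x \<in> eucl n" "\<rho> (e x) = 1" if "x \<in> M" for x
        using t that by (auto simp: tube_def)
      show "(\<lambda>x. sh c (e x)) \<in> M \<rightarrow> half_eucl n"
      proof
        fix x assume "x \<in> M"
        then show "sh c (e x) \<in> half_eucl n"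
          using e large[of "sh c (e x)"] sh_eucl by (auto simp: half_eucl_def)
      qed
      show "\<rho> (sh (- c) (sh c (e x))) = 1" if "x \<in> M" for x
        using e[OF that] by simp
      show "sh c (e (U (sh (- c) z))) = z" if "z \<in> half_eucl n" "\<rho> (sh (- c) z) = 1" for z
      proof -
        have "e (U (sh (- c) z)) = sh (- c) z"
          using t that sh_eucl half by (auto simp: tube_def)
        then show ?thesis by simp
      qed
      show pos: "0 < \<alpha> + c" using t by (auto simp: tube_def c_def)
      then show "axis_point (\<alpha> + c) \<in> half_eucl n"
        using axis_point_in_eucl[OF n] by (simp add: half_eucl_def)
      show "\<rho> (sh (- c) (axis_point (\<alpha> + c))) < 1/2"
        using t by (simp add: sh_axis tube_def)
      show "x = d" if "x \<in> M" "\<alpha> + c \<le> s" "sh c (e x) = axis_point s" for x s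
      proof -
        have "e x = sh (- c) (sh c (e x))" by simp
        then have "e x = axis_point (s - c)" using that(3) by (simp add: sh_axis)
        moreover have "\<alpha> \<le> s - c" using that(2) by simp
        ultimately show ?thesis using t that(1) unfolding tube_def by blast
      qed
    qed
  qed
qed

text \<open>
  Alternating rotations and translations gives a solid torus of revolution, then the body swept out by
  rotating that torus, and so on: every product of spheres is such a boundary. The distinguished point
  has all its coordinates at the pole \<open>axis_point 1\<close>.
\<close>

lemma tube_exists:
  "\<exists>p \<rho> U e \<alpha> B. tube (Suc p) (PiE {1..Suc r} (\<lambda>i. unit_sphere (k i))) (\<lambda>i\<in>{1..Suc r}. axis_point 1)
     (eucl (Suc p)) \<rho> U e \<alpha> B"
proof (induction r)
  case 0
  have "tube (k 1 + 1) (PiE {1..Suc 0} (\<lambda>i. unit_sphere (k i))) ((\<lambda>_. undefined)(Suc 0 := axis_point 1))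
     (eucl (k 1 + 1)) (\<lambda>z. fold_head (k 1) z 0) (\<lambda>z. (\<lambda>_. undefined)(Suc 0 := direction (k 1) z))
    (\<lambda>x. unfold_head (k 1) (axis_point 1) (x (Suc 0))) (1/4) 1"
    by (rule tube_fold[of 1 0 _ _ "\<lambda>x. x 0"]) (use tube_point in auto)
  moreover have "((\<lambda>_. undefined)(Suc 0 := axis_point 1)) = (\<lambda>i\<in>{1..Suc 0}. axis_point 1)"
    by (auto simp: fun_eq_iff)
  ultimately show ?case by (metis Suc_eq_plus1)
next
  case (Suc r)
  let ?S = "\<lambda>i. unit_sphere (k i)"
  obtain p \<rho> U e \<alpha> B where t: "tube (Suc p) (PiE {1..Suc r} ?S) (\<lambda>i\<in>{1..Suc r}. axis_point 1)
     (eucl (Suc p)) \<rho> U e \<alpha> B"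
    using Suc by blast
  obtain \<rho>' U' e' \<alpha>' B' where "tube (Suc p) (PiE {1..Suc r} ?S) (\<lambda>i\<in>{1..Suc r}. axis_point 1) (half_eucl (Suc p)) \<rho>' U' e' \<alpha>' B'"
    "\<forall>z\<in>half_eucl (Suc p). 1/2 \<le> \<rho>' z \<and> \<rho>' z \<le> 1 \<longrightarrow> 0 < z 0"
    by (rule tube_shift[OF t]) auto
  from tube_fold[OF this(1) _ this(2), of "k (Suc (Suc r))"]
  obtain \<rho>'' U'' e'' where "tube (k (Suc (Suc r)) + Suc p) (PiE {1..Suc (Suc r)} ?S) ((\<lambda>i\<in>{1..Suc r}. axis_point 1)(Suc (Suc r) := axis_point 1))
     (eucl (k (Suc (Suc r)) + Suc p)) \<rho>'' U'' e'' \<alpha>' B'"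
    by auto
  moreover have "(\<lambda>i\<in>{1..Suc r}. axis_point 1)(Suc (Suc r) := axis_point 1) = (\<lambda>i\<in>{1..Suc (Suc r)}. axis_point 1)"
    by (auto simp: fun_eq_iff)
  ultimately show ?case by (metis add_Suc_right)
qed

section \<open>Maps homotopic to the identity attain the point of poles\<close>

text \<open>
  The boundary of the body winds around the interior point \<open>a = axis_point \<alpha>\<close>. If its embedding were
  null-homotopic in the complement of \<open>a\<close>, then the null-homotopy, run through the collar, would
  give a map \<open>Q\<close> of all of Euclidean space into that complement which is the identity outside the body.
  Restricting \<open>Q\<close> to the concentric spheres from radius 0 to a large radius \<open>R\<close> and projecting radially from
  \<open>a\<close> would contract a sphere, contrary to \<open>non_contractible_space_nsphere\<close>.
\<close>

lemma tube_not_nullhomotopic: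
  assumes t: "tube (Suc p) M d (eucl (Suc p)) \<rho> U e \<alpha> B"
    and hom: "homotopic_maps M (eucl (Suc p) - {axis_point \<alpha>}) e (\<lambda>_. q)"
    and q: "q \<in> eucl (Suc p) - {axis_point \<alpha>}"
  shows False
proof -
  let ?E = "eucl (Suc p)" and ?a = "axis_point \<alpha>"
  obtain K where K: "continuous_on ({0..1::real} \<times> M) K" "K \<in> {0..1} \<times> M \<rightarrow> ?E - {?a}"
     "\<And>x. K (0, x) = e x" "\<And>x. K (1, x) = q"
    using hom unfolding homotopic_with_def by auto
  have \<rho>: "continuous_on ?E \<rho>" and \<alpha>: "0 < \<alpha>" and aE: "?a \<in> ?E" and \<rho>a: "\<rho> ?a < 1/2"
    using t by (auto simp: tube_def)
  have UM: "U z \<in> M" if "z \<in> ?E" "1/2 \<le> \<rho> z" "\<rho> z \<le> 1" for z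
    using t that by (auto simp: tube_def)
  \<comment> \<open>Time runs from 0 on the outer boundary of the collar to 1 on the inner one.\<close>
  define K' where "K' z = K (2 * (1 - \<rho> z), U z)" for z
  have cK': "continuous_on {z \<in> ?E. 1/2 \<le> \<rho> z \<and> \<rho> z \<le> 1} K'"
    unfolding K'_def
    by (rule continuous_on_compose2[OF K(1)])
      (use t UM in \<open>auto simp: tube_def intro!: continuous_on_Pair continuous_on_mult continuous_on_diff
          continuous_on_const intro: continuous_on_subset[OF \<rho>]\<close>)
  have K'im: "K' z \<in> ?E - {?a}" if "z \<in> ?E" "1/2 \<le> \<rho> z" "\<rho> z \<le> 1" for z
    using UM[OF that] K(2) that unfolding K'_def by (auto simp: Pi_iff)
  define Q where "Q z = (if \<rho> z \<le> 1 then (if \<rho> z \<le> 1/2 then q else K' z) else z)" for z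
  have cQ: "continuous_on ?E Q"
    unfolding Q_def
  proof (rule continuous_on_cases_le[OF _ continuous_on_id \<rho>])
    show "continuous_on {x \<in> ?E. \<rho> x \<le> 1} (\<lambda>z. if \<rho> z \<le> 1/2 then q else K' z)"
    proof (rule continuous_on_cases_le[OF continuous_on_const])
      show "continuous_on {x \<in> {x \<in> ?E. \<rho> x \<le> 1}. 1/2 \<le> \<rho> x} K'"
        by (rule continuous_on_subset[OF cK']) auto
      show "continuous_on {x \<in> ?E. \<rho> x \<le> 1} \<rho>"
        by (rule continuous_on_subset[OF \<rho>]) auto
      show "q = K' z" if "z \<in> {x \<in> ?E. \<rho> x \<le> 1}" "\<rho> z = 1/2" for z
      proof -
        have "2 * (1 - \<rho> z) = 1" using that(2) by simp
        then show ?thesis unfolding K'_def by (simp only: K(4))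
      qed
    qed
    show "(if \<rho> z \<le> 1/2 then q else K' z) = z" if "z \<in> ?E" "\<rho> z = 1" for z
      using that t by (simp add: K'_def K(3) tube_def)
  qed
  have Qim: "Q z \<in> ?E - {?a}" if "z \<in> ?E" for z
  proof -
    show ?thesis using K'im[of z] that \<rho>a q by (auto simp: Q_def)
  qed
  \<comment> \<open>The sphere of radius \<open>R\<close> lies outside the body and encloses the point \<open>axis_point \<alpha>\<close>.\<close>
  define R where "R = \<bar>B\<bar> + \<alpha> + 1"
  have R: "0 < R" "\<alpha> < R" "B < R\<^sup>2"
    using \<alpha> by (auto simp: R_def power2_eq_square algebra_simps) (smt (verit) zero_le_mult_iff)
  have scaleE: "(\<lambda>i. s * x i) \<in> ?E" if "x \<in> unit_sphere p" for s x
    using that by (auto simp: eucl_def unit_sphere_def)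
  define g where "g = (\<lambda>(s, x) i. Q (\<lambda>i. R * s * x i) i - ?a i)"
  have gE: "g (s, x) \<in> ?E" if "x \<in> unit_sphere p" for s x
    using Qim[OF scaleE[OF that, of "R * s"]] aE by (auto simp: g_def eucl_def)
  have nz: "head_norm p (g (s, x)) \<noteq> 0" if "x \<in> unit_sphere p" for s x
  proof
    assume "head_norm p (g (s, x)) = 0"
    then have "g (s, x) i = 0" for i
      using gE[OF that, of s] by (cases "i \<le> p") (auto simp: head_norm_eq_0 eucl_def)
    then have "Q (\<lambda>i. R * s * x i) = ?a" by (auto simp: g_def fun_eq_iff)
    then show False using Qim[OF scaleE[OF that, of "R * s"]] by simp
  qed
  have cg: "continuous_on ({0..1} \<times> unit_sphere p) g"
  proof (rule continuous_on_coordinatewise_then_product)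
    fix i
    have c1: "continuous_on ({0..1} \<times> unit_sphere p) (\<lambda>z. Q (\<lambda>i. R * fst z * snd z i))"
    proof (rule continuous_on_compose2[OF cQ])
      show "continuous_on ({0..1} \<times> unit_sphere p) (\<lambda>z i. R * fst z * snd z i)"
      proof (rule continuous_on_coordinatewise_then_product)
        show "continuous_on ({0..1} \<times> unit_sphere p) (\<lambda>z. R * fst z * snd z i)" for i
          by (intro continuous_on_mult continuous_on_const continuous_on_fst continuous_on_id
              continuous_on_product_then_coordinatewise[OF continuous_on_snd])
      qed
    qed (use scaleE in auto)
    show "continuous_on ({0..1} \<times> unit_sphere p) (\<lambda>z. g z i)"
      unfolding g_def case_prod_unfold
      by (intro continuous_on_diff continuous_on_const continuous_on_product_then_coordinatewise[OF c1])
  qed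
  have 1: "homotopic_maps (unit_sphere p) (unit_sphere p)
     (\<lambda>x. direction p (g (0, x))) (\<lambda>x. direction p (g (1, x)))"
  proof (rule homotopic_mapsI)
    show "continuous_on ({0..1} \<times> unit_sphere p) (\<lambda>z. direction p (g z))"
      using nz by (intro continuous_on_direction cg) auto
  qed (use nz direction_in_sphere in auto)
  have const: "(\<lambda>x. direction p (g (0, x))) = (\<lambda>_. direction p (\<lambda>i. Q (\<lambda>_. 0) i - ?a i))"
    by (simp add: g_def)
  \<comment> \<open>On the outer sphere \<open>Q\<close> is the identity, and the view from a point inside is never antipodal
    to the view from the centre.\<close>
  have 2: "homotopic_maps (unit_sphere p) (unit_sphere p) (\<lambda>x. direction p (g (1, x))) id"
  proof (rule homotopic_maps_sphere_non_antipodal)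
    show "continuous_on (unit_sphere p) (\<lambda>x. direction p (g (1, x)))"
      using nz by (intro continuous_on_direction continuous_on_compose2[OF cg] continuous_on_Pair
          continuous_on_const continuous_on_id) auto
    fix x assume x: "x \<in> unit_sphere p"
    have Q1: "Q (\<lambda>i. R * x i) = (\<lambda>i. R * x i)"
    proof -
      have "(\<Sum>i<Suc p. (R * x i)\<^sup>2) = R\<^sup>2"
        using x by (simp add: unit_sphere_def power_mult_distrib lessThan_Suc_atMost flip: sum_distrib_left)
      then have "\<rho> (\<lambda>i. R * x i) > 1"
        using t scaleE[OF x, of R] R(3) unfolding tube_def by (metis linorder_not_le)
      then show ?thesis by (simp add: Q_def)
    qed
    show "direction p (g (1, x)) \<noteq> (\<lambda>i. - id x i)"
    proof
      assume eq: "direction p (g (1, x)) = (\<lambda>i. - id x i)"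
      define m where "m = head_norm p (g (1, x))"
      have "g (1, x) i = - m * x i" if "i \<le> p" for i
        using fun_cong[OF eq, of i] that nz[OF x, of 1] by (simp add: direction_def m_def field_simps)
      then have "?a i = (R + m) * x i" if "i \<le> p" for i
        using that by (simp add: g_def Q1 algebra_simps)
      then have "head_norm p ?a = head_norm p (\<lambda>i. (R + m) * x i)"
        by (rule head_norm_cong)
      then have "\<alpha> = R + m"
        using R \<alpha> head_norm_sphere[OF x] by (simp add: head_norm_scale m_def add_nonneg_nonneg)
      then show False using R(2) head_norm_nonneg[of p "g (1, x)"] by (simp add: m_def)
    qed
  qed (use nz direction_in_sphere in \<open>auto simp: id_def\<close>)
  have "homotopic_maps (unit_sphere p) (unit_sphere p) id (\<lambda>_. direction p (\<lambda>i. Q (\<lambda>_. 0) i - ?a i))"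
    using homotopic_with_symD[OF homotopic_with_trans[OF 1 2]] unfolding const .
  then have "contractible_space (nsphere p)"
    unfolding contractible_space_def nsphere_eq_top_of_set by blast
  then show False using non_contractible_space_nsphere by blast
qed

text \<open>
  If the identity of \<open>M\<close> is homotopic to a map \<open>F\<close> that avoids \<open>d\<close>, the embedding \<open>e\<close> may be replaced by
  \<open>e \<circ> F\<close>, whose image misses the ray that starts at \<open>a = axis_point \<alpha>\<close>. It can then be translated
  backwards along the axis without ever hitting \<open>a\<close>, until it lies in a half space not
  containing \<open>a\<close>, where it contracts linearly to the origin.
\<close>

lemma tube_nullhomotopic_avoiding:
  assumes t: "tube n M d (eucl n) \<rho> U e \<alpha> B" and n: "0 < n"
    and hom: "homotopic_maps M M (\<lambda>x. x) F" and F: "d \<notin> F ` M"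
  shows "homotopic_maps M (eucl n - {axis_point \<alpha>}) e (\<lambda>_. axis_point 0)"
proof -
  let ?E = "eucl n - {axis_point \<alpha>}"
  \<comment> \<open>After a translation by \<open>T\<close> coordinate 0 of the image is nonpositive.\<close>
  define T where "T = \<bar>B\<bar> + 1"
  have ce: "continuous_on M e" and \<alpha>: "0 < \<alpha>" using t by (auto simp: tube_def)
  have F_M: "F x \<in> M" if "x \<in> M" for x
    using homotopic_with_imp_subset2[OF hom] that by blast
  have cF: "continuous_on M F" using homotopic_with_imp_continuous[OF hom] by simp
  have eE: "e x \<in> eucl n" "e x \<in> ?E"
    and eB: "(\<Sum>i<n. (e x i)\<^sup>2) \<le> B" if "x \<in> M" for x
  proof -
    have "\<forall>z\<in>eucl n. \<rho> z \<le> 1 \<longrightarrow> (\<Sum>i<n. (z i)\<^sup>2) \<le> B" using t by (simp add: tube_def)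
    moreover have "e x \<in> eucl n" "\<rho> (e x) = 1" "\<rho> (axis_point \<alpha>) < 1/2"
      using t that by (auto simp: tube_def)
    ultimately show "e x \<in> eucl n" "e x \<in> ?E" "(\<Sum>i<n. (e x i)\<^sup>2) \<le> B" by auto
  qed
  have cF': "continuous_on M (\<lambda>x. e (F x))"
    by (rule continuous_on_compose2[OF ce cF]) (use F_M in auto)
  have "homotopic_maps M ?E (e \<circ> (\<lambda>x. x)) (e \<circ> F)"
    by (rule homotopic_with_compose_continuous_left[OF hom ce]) (use eE in auto)
  then have 1: "homotopic_maps M ?E e (\<lambda>x. e (F x))" by (simp add: o_def)
  have eF0: "e (F x) 0 \<le> T" if "x \<in> M" for x
  proof -
    have "(e (F x) 0)\<^sup>2 \<le> (\<Sum>i<n. (e (F x) i)\<^sup>2)" using n by (intro member_le_sum) auto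
    also have "\<dots> \<le> B" using eB[OF F_M[OF that]] .
    also have "\<dots> \<le> T\<^sup>2" by (simp add: T_def power2_sum) (smt (verit) zero_le_power2)
    finally show ?thesis using abs_le_square_iff[of "e (F x) 0" T] by (simp add: T_def)
  qed
  have ceF: "continuous_on ({0..1::real} \<times> M) (\<lambda>z. e (F (snd z)) i)" for i
    by (rule continuous_on_product_then_coordinatewise)
      (rule continuous_on_compose2[OF cF'], auto intro: continuous_on_snd)
  have 2: "homotopic_maps M ?E (\<lambda>x. e (F x)) (\<lambda>x i. e (F x) i - axis_point T i)"
  proof (rule homotopic_mapsI)
    show "continuous_on ({0..1} \<times> M) (\<lambda>z i. e (F (snd z)) i - fst z * axis_point T i)"
      by (intro continuous_on_coordinatewise_then_product continuous_on_diff ceF continuous_on_mult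
          continuous_on_fst continuous_on_id continuous_on_const)
    show "(\<lambda>i. e (F (snd (s, x))) i - fst (s, x) * axis_point T i) \<in> ?E"
      if s: "0 \<le> s" "s \<le> 1" and x: "x \<in> M" for s x
    proof -
      have "e (F x) = axis_point (\<alpha> + s * T)" if "(\<lambda>i. e (F x) i - s * axis_point T i) = axis_point \<alpha>"
        using fun_cong[OF that] by (auto simp: fun_eq_iff axis_point_def algebra_simps split: if_splits)
      moreover have "e (F x) \<noteq> axis_point (\<alpha> + s * T)"
      proof
        assume eq: "e (F x) = axis_point (\<alpha> + s * T)"
        have "\<alpha> \<le> \<alpha> + s * T" using s by (simp add: T_def)
        with eq t F_M[OF x] have "F x = d" unfolding tube_def by blast
        then show False using F x by blast
      qed
      moreover have "(\<lambda>i. e (F x) i - s * axis_point T i) \<in> eucl n"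
        using eE(1)[OF F_M[OF x]] axis_point_in_eucl[OF n, of T] by (auto simp: eucl_def)
      ultimately show ?thesis by auto
    qed
  qed auto
  have 3: "homotopic_maps M ?E (\<lambda>x i. e (F x) i - axis_point T i) (\<lambda>_. axis_point 0)"
  proof (rule homotopic_mapsI)
    show "continuous_on ({0..1} \<times> M) (\<lambda>z i. (1 - fst z) * (e (F (snd z)) i - axis_point T i))"
      by (intro continuous_on_coordinatewise_then_product continuous_on_diff ceF continuous_on_mult
          continuous_on_fst continuous_on_id continuous_on_const)
    show "(\<lambda>i. (1 - fst (s, x)) * (e (F (snd (s, x))) i - axis_point T i)) \<in> ?E"
      if s: "0 \<le> s" "s \<le> 1" and x: "x \<in> M" for s x
    proof -
      have "(1 - s) * (e (F x) 0 - axis_point T 0) \<le> 0"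
        using s eF0[OF x] by (simp add: mult_nonneg_nonpos)
      then have "(\<lambda>i. (1 - s) * (e (F x) i - axis_point T i)) \<noteq> axis_point \<alpha>"
        using \<alpha> by (metis axis_point_0 linorder_not_le)
      moreover have "(\<lambda>i. (1 - s) * (e (F x) i - axis_point T i)) \<in> eucl n"
        using eE(1)[OF F_M[OF x]] axis_point_in_eucl[OF n, of T] by (auto simp: eucl_def)
      ultimately show ?thesis by auto
    qed
  qed (auto simp: axis_point_def)
  show ?thesis
    using homotopic_with_trans[OF homotopic_with_trans[OF 1 2] 3] .
qed

text \<open>
  This replaces the usual cup product argument for the lower bound: it says, in the only form needed
  here, that the top-dimensional class of the product of spheres is nontrivial.
\<close>

lemma homotopic_id_attains_poles:
  fixes r :: nat
  assumes "1 \<le> r"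
    and hom: "homotopic_maps (PiE {1..r} (\<lambda>i. unit_sphere (k i))) (PiE {1..r} (\<lambda>i. unit_sphere (k i))) (\<lambda>x. x) F"
  shows "(\<lambda>i\<in>{1..r}. axis_point 1) \<in> F ` (PiE {1..r} (\<lambda>i. unit_sphere (k i)))"
proof (rule ccontr)
  assume F: "\<not> ?thesis"
  obtain r' where r: "r = Suc r'" using assms(1) by (cases r) auto
  obtain p \<rho> U e \<alpha> B where t: "tube (Suc p) (PiE {1..r} (\<lambda>i. unit_sphere (k i))) (\<lambda>i\<in>{1..r}. axis_point 1)
     (eucl (Suc p)) \<rho> U e \<alpha> B"
    using tube_exists[of r' k, folded r] by (elim exE) (rule that)
  have "0 < \<alpha>" using t by (simp add: tube_def)
  then have "axis_point 0 \<noteq> axis_point \<alpha>" by (metis axis_point_0 less_irrefl)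
  then have q: "axis_point 0 \<in> eucl (Suc p) - {axis_point \<alpha>}"
    using axis_point_in_eucl[of "Suc p" 0] by simp
  have null: "homotopic_maps (PiE {1..r} (\<lambda>i. unit_sphere (k i))) (eucl (Suc p) - {axis_point \<alpha>}) e (\<lambda>_. axis_point 0)"
    using tube_nullhomotopic_avoiding[of "Suc p" "PiE {1..r} (\<lambda>i. unit_sphere (k i))" "\<lambda>i\<in>{1..r}. axis_point 1" \<rho> U e \<alpha> B F, OF t zero_less_Suc hom F] .
  show False
    using tube_not_nullhomotopic[of p _ _ \<rho> U e \<alpha> B "axis_point 0", OF t null q] .
qed

section \<open>The category of a product of spheres\<close>

text \<open>
  The hypothesis that the spheres have positive dimension ensures that coordinate 0 takes every value
  between 0 and 1 on each of them, so that each of the \<open>r + 1\<close> bands is nonempty. The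
  coordinatewise null-homotopies combine into one on each member of the cover.
\<close>

lemma ls_cat_product_spheres_le:
  assumes "\<And>i. i \<in> {1..r} \<Longrightarrow> 1 \<le> k i"
  shows "ls_cat (product_topology (\<lambda>i. nsphere (k i)) {1..r}) \<le> enat (r + 1)"
proof -
  let ?S = "\<lambda>i. unit_sphere (k i)"
  let ?M = "PiE {1..r} ?S"
  \<comment> \<open>Coordinate 0 is rescaled by \<open>r + 1\<close>, so that the bands become unit intervals
    (\<open>j - 1\<close>, \<open>j\<close>) with \<open>j = 1, ..., r + 1\<close>.\<close>
  define band where "band j = {real j - 1 <..< real j}" for j
  define C where "C j i = {y \<in> ?S i. real (r + 1) * y 0 \<notin> band j}" for i j
  have "closedin (top_of_set ?M) (PiE {1..r} (C j))" for j
  proof -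
    have "closedin (top_of_set (?S i)) (C j i)" for i
    proof -
      have "closedin (top_of_set (?S i)) (?S i \<inter> (\<lambda>y. real (r + 1) * y 0) -` (- band j))"
        by (intro continuous_closedin_preimage continuous_on_mult continuous_on_const continuous_on_coordinate)
          (auto simp: band_def)
      moreover have "?S i \<inter> (\<lambda>y. real (r + 1) * y 0) -` (- band j) = C j i" by (auto simp: C_def)
      ultimately show ?thesis by simp
    qed
    then show ?thesis
      by (simp add: closedin_product_topology flip: product_topology_top_of_set)
  qed
  moreover have "contractible_within (top_of_set ?M) (PiE {1..r} (C j))" if j: "j \<in> {1..r + 1}" for j
  proof -
    have "\<exists>q. q \<in> ?S i \<and> homotopic_maps (C j i) (?S i) (\<lambda>x. x) (\<lambda>_. q)" if i: "i \<in> {1..r}" for i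
    proof -
      \<comment> \<open>The centre of band \<open>j\<close>; coordinate 1 is available because the sphere has positive dimension.\<close>
      define s where "s = (real j - 1/2) / real (r + 1)"
      define y where "y = (\<lambda>n::nat. if n = 0 then s else if n = 1 then sqrt (1 - s\<^sup>2) else 0)"
      have "\<bar>s\<bar> \<le> 1" using j by (auto simp: s_def field_simps)
      then have "0 \<le> 1 - s\<^sup>2" by (simp add: abs_square_le_1)
      moreover have "(\<Sum>n\<le>k i. (y n)\<^sup>2) = (\<Sum>n\<in>{0,1}. (y n)\<^sup>2)"
        using assms[OF i] by (intro sum.mono_neutral_right) (auto simp: y_def)
      ultimately have y: "y \<in> ?S i"
        using assms[OF i] by (auto simp: unit_sphere_def y_def)
      have "real (r + 1) * y 0 \<in> band j" by (auto simp: y_def s_def band_def)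
      then have "y \<notin> C j i" by (simp add: C_def)
      with inclusion_sphere_nullhomotopic[of "C j i" "k i" y] y
      show ?thesis using unit_sphere_uminus[OF y] by (auto simp: C_def)
    qed
    then obtain q where q: "\<And>i. i \<in> {1..r} \<Longrightarrow> q i \<in> ?S i"
      "\<And>i. i \<in> {1..r} \<Longrightarrow> homotopic_maps (C j i) (?S i) (\<lambda>x. x) (\<lambda>_. q i)"
      by metis
    have sub: "PiE {1..r} (C j) \<subseteq> ?M" by (auto simp: C_def PiE_def Pi_iff)
    have "homotopic_maps (PiE {1..r} (C j)) ?M id (\<lambda>_. restrict q {1..r})"
    proof (rule homotopic_maps_PiE)
      fix i assume i: "i \<in> {1..r}"
      have "homotopic_maps (PiE {1..r} (C j)) (?S i) ((\<lambda>x. x) \<circ> (\<lambda>x. x i)) ((\<lambda>_. q i) \<circ> (\<lambda>x. x i))"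
        by (rule homotopic_with_compose_continuous_right[OF q(2)[OF i] continuous_on_coordinate])
          (use i in auto)
      then show "homotopic_maps (PiE {1..r} (C j)) (?S i) (\<lambda>x. id x i) (\<lambda>_. restrict q {1..r} i)"
        using i by (simp add: o_def)
    qed (auto simp: PiE_def)
    moreover have "restrict q {1..r} \<in> ?M" using q(1) by auto
    ultimately have "\<exists>c\<in>?M. homotopic_maps (PiE {1..r} (C j)) ?M id (\<lambda>_. c)" by (rule bexI)
    then show ?thesis
      using sub by (simp only: contractible_within_def subtopology_subtopology Int_absorb1 topspace_euclidean_subtopology)
  qed
  moreover have "(\<Union>j\<in>{1..r + 1}. PiE {1..r} (C j)) = ?M"
  proof
    show "(\<Union>j\<in>{1..r + 1}. PiE {1..r} (C j)) \<subseteq> ?M" by (auto simp: C_def PiE_def Pi_iff)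
    show "?M \<subseteq> (\<Union>j\<in>{1..r + 1}. PiE {1..r} (C j))"
    proof
      fix x assume x: "x \<in> ?M"
      \<comment> \<open>The only band that can contain coordinate \<open>i\<close> of \<open>x\<close> is the one with number \<open>b i\<close>, and one of
        the \<open>r + 1\<close> numbers is not of this form.\<close>
      define b where "b i = nat \<lceil>real (r + 1) * x i 0\<rceil>" for i
      have b: "b i = j" if "real (r + 1) * x i 0 \<in> band j" for i j
      proof -
        have "\<lceil>real (r + 1) * x i 0\<rceil> = int j"
          by (rule ceiling_unique) (use that in \<open>auto simp: band_def\<close>)
        then show ?thesis unfolding b_def by simp
      qed
      have "card (b ` {1..r}) < card {1..r + 1}"
        using card_image_le[of "{1..r}" b] by simp
      then obtain j where j: "j \<in> {1..r + 1}" "j \<notin> b ` {1..r}"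
        by (metis card_mono finite_atLeastAtMost finite_imageI linorder_not_le subsetI)
      have "x i \<in> C j i" if "i \<in> {1..r}" for i
        using x that b[of i j] j(2) unfolding C_def by blast
      then have "x \<in> PiE {1..r} (C j)"
        using x by (simp add: PiE_iff)
      then show "x \<in> (\<Union>j\<in>{1..r + 1}. PiE {1..r} (C j))" using j by blast
    qed
  qed
  ultimately show ?thesis
    unfolding ls_cat_def nsphere_eq_top_of_set product_topology_top_of_set
    by (intro Inf_lower) (auto intro!: exI[of _ "\<lambda>j. PiE {1..r} (C j)"])
qed

text \<open>
  Non-antipodal points are joined by a projected segment. Two arbitrary points are joined through a third
  one that is antipodal to neither, chosen among three points of the sphere; on a 0-sphere there is
  none.
\<close>

lemma path_component_unit_sphere:
  assumes "1 \<le> k" "x \<in> unit_sphere k" "y \<in> unit_sphere k"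
  shows "path_component_of (top_of_set (unit_sphere k)) x y"
proof -
  have near: "path_component_of (top_of_set (unit_sphere k)) u v"
    if "u \<in> unit_sphere k" "v \<in> unit_sphere k" "v \<noteq> (\<lambda>i. - u i)" for u v
  proof -
    have "homotopic_maps {0::nat} (unit_sphere k) (\<lambda>_. u) (\<lambda>_. v)"
      using that by (intro homotopic_maps_sphere_non_antipodal) auto
    then show ?thesis
      unfolding homotopic_constant_maps by (metis insert_not_empty topspace_euclidean_subtopology topspace_discrete_topology discrete_topology_unique)
  qed
  define e1 where "e1 = (\<lambda>i::nat. if i = 1 then 1 else 0 :: real)"
  have "(\<Sum>i\<le>k. (e1 i)\<^sup>2) = (\<Sum>i\<in>{1}. (e1 i)\<^sup>2)"
    using assms(1) by (intro sum.mono_neutral_right) (auto simp: e1_def)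
  then have e1: "e1 \<in> unit_sphere k" using assms(1) by (auto simp: unit_sphere_def e1_def)
  have "\<exists>z\<in>{axis_point 1, \<lambda>i. - axis_point 1 i, e1}. z \<noteq> (\<lambda>i. - x i) \<and> z \<noteq> (\<lambda>i. - y i)"
  proof -
    have ne: "a \<noteq> b" if "a 0 \<noteq> b 0" for a b :: "nat \<Rightarrow> real"
      using that by auto
    have "axis_point 1 \<noteq> (\<lambda>i. - axis_point 1 i)" "axis_point 1 \<noteq> e1" "e1 \<noteq> (\<lambda>i. - axis_point 1 i)"
      by (rule ne, simp add: e1_def)+
    moreover have "\<exists>z\<in>{a, b, c}. z \<noteq> v \<and> z \<noteq> w" if "a \<noteq> b" "a \<noteq> c" "c \<noteq> b" for a b c v w :: "nat \<Rightarrow> real"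
      using that by (cases "a = v \<or> a = w"; cases "b = v \<or> b = w") auto
    ultimately show ?thesis by blast
  qed
  then obtain z where "z \<in> unit_sphere k" "z \<noteq> (\<lambda>i. - x i)" "z \<noteq> (\<lambda>i. - y i)"
    using e1 axis_point_in_sphere unit_sphere_uminus[OF axis_point_in_sphere] by blast
  then show ?thesis
    using near[OF assms(2)] near[OF assms(3)] by (metis path_component_of_sym path_component_of_trans)
qed

text \<open>
  A set \<open>A i\<close> contractible in the product has null-homotopic \<open>i\<close>-th projection, so by homotopy extension
  this projection can be deformed to a map \<open>g i\<close> that takes the single value \<open>- axis_point 1\<close> on \<open>A i\<close>.
  With at most \<open>r\<close> sets there are enough factors to give each set its own, and at every point some
  \<open>g i\<close> then differs from the pole. The map with components \<open>g i\<close> is homotopic to the identity and yet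
  avoids the point whose coordinates are all poles.
\<close>

lemma product_spheres_le_ls_cat:
  assumes k: "\<And>i. i \<in> {1..r} \<Longrightarrow> 1 \<le> k i"
  shows "enat (r + 1) \<le> ls_cat (product_topology (\<lambda>i. nsphere (k i)) {1..r})"
proof -
  let ?S = "\<lambda>i. unit_sphere (k i)"
  let ?M = "PiE {1..r} ?S"
  have "r < n" if A: "\<And>i. i \<in> {1..n} \<Longrightarrow> closedin (top_of_set ?M) (A i) \<and> contractible_within (top_of_set ?M) (A i)"
    and cover: "(\<Union>i\<in>{1..n}. A i) = ?M" for n A
  proof (rule ccontr)
    assume "\<not> r < n"
    have M0: "(\<lambda>i\<in>{1..r}. axis_point 1) \<in> ?M" using axis_point_in_sphere by auto
    have "n \<noteq> 0" using cover M0 by (intro notI) auto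
    then have "1 \<le> r" using \<open>\<not> r < n\<close> by simp
    have cM: "compact ?M" by (intro compact_PiE compact_unit_sphere)
    have "\<exists>g. homotopic_maps ?M (?S i) (\<lambda>x. x i) g \<and> (i \<le> n \<longrightarrow> (\<forall>x\<in>A i. g x \<noteq> axis_point 1))"
      if i: "i \<in> {1..r}" for i
    proof (cases "i \<le> n")
      case False
      have "homotopic_maps ?M (?S i) (\<lambda>x. x i) (\<lambda>x. x i)"
        using i by (auto intro: continuous_on_coordinate)
      then show ?thesis using False by blast
    next
      case True
      then have clo: "closedin (top_of_set ?M) (A i)" and "contractible_within (top_of_set ?M) (A i)"
        using A i by auto
      then obtain c where c: "c \<in> ?M" "homotopic_with (\<lambda>_. True) (subtopology (top_of_set ?M) (A i)) (top_of_set ?M) id (\<lambda>_. c)"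
        by (auto simp: contractible_within_def)
      have AM: "A i \<subseteq> ?M" using clo closedin_subset by fastforce
      have "homotopic_maps (A i) ?M id (\<lambda>_. c)"
        using c(2) AM by (simp add: subtopology_subtopology Int_absorb1)
      then have "homotopic_maps (A i) (?S i) ((\<lambda>x. x i) \<circ> id) ((\<lambda>x. x i) \<circ> (\<lambda>_. c))"
        by (rule homotopic_with_compose_continuous_left[OF _ continuous_on_coordinate]) (use i in auto)
      moreover
      let ?q = "\<lambda>n. - axis_point 1 n"
      have ci: "c i \<in> ?S i" using c(1) i by auto
      have q: "?q \<in> ?S i" using unit_sphere_uminus[OF axis_point_in_sphere] .
      have "homotopic_maps (A i) (?S i) (\<lambda>_. c i) (\<lambda>_. ?q)"
        unfolding homotopic_constant_maps
        using path_component_unit_sphere[OF k[OF i] ci q] by blast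
      ultimately have "homotopic_maps (A i) (?S i) (\<lambda>x. x i) (\<lambda>_. ?q)"
        by (auto simp: o_def intro: homotopic_with_trans)
      then obtain g where "homotopic_maps ?M (?S i) (\<lambda>x. x i) g" "\<And>x. x \<in> A i \<Longrightarrow> g x = ?q"
        by (rule homotopy_extension_sphere[OF cM clo continuous_on_coordinate, rotated]) (use i in auto)
      moreover have "?q \<noteq> axis_point 1"
        by (auto simp: fun_eq_iff intro!: exI[of _ 0])
      ultimately show ?thesis by metis
    qed
    then have "\<forall>i\<in>{1..r}. \<exists>g. homotopic_maps ?M (?S i) (\<lambda>x. x i) g \<and> (i \<le> n \<longrightarrow> (\<forall>x\<in>A i. g x \<noteq> axis_point 1))"
      by blast
    from bchoice[OF this] obtain g where g:
      "\<forall>i\<in>{1..r}. homotopic_maps ?M (?S i) (\<lambda>x. x i) (g i) \<and> (i \<le> n \<longrightarrow> (\<forall>x\<in>A i. g i x \<noteq> axis_point 1))"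
      by (rule exE)
    let ?F = "\<lambda>x. \<lambda>i\<in>{1..r}. g i x"
    have "homotopic_maps ?M ?M (\<lambda>x. x) ?F"
    proof (rule homotopic_maps_PiE)
      fix i assume i: "i \<in> {1..r}"
      then have "(\<lambda>x. ?F x i) = g i" by simp
      then show "homotopic_maps ?M (?S i) (\<lambda>x. x i) (\<lambda>x. ?F x i)"
        using bspec[OF g i] by (simp only:)
    qed (auto simp: PiE_def)
    from homotopic_id_attains_poles[OF \<open>1 \<le> r\<close> this]
    obtain x where x: "(\<lambda>i\<in>{1..r}. axis_point 1) = ?F x" "x \<in> ?M"
      by (rule imageE)
    then obtain i where i: "i \<in> {1..n}" "x \<in> A i" using cover x(2) by blast
    then have ir: "i \<in> {1..r}" using \<open>\<not> r < n\<close> by auto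
    have "g i x \<noteq> axis_point 1" using bspec[OF g ir] i by simp
    then show False using fun_cong[OF x(1), of i] ir by simp
  qed
  note bound = this
  show ?thesis
    unfolding ls_cat_def nsphere_eq_top_of_set product_topology_top_of_set
  proof (rule Inf_greatest)
    fix c assume "c \<in> {enat n |n. \<exists>A. (\<forall>i\<in>{1..n}. closedin (top_of_set ?M) (A i) \<and>
      contractible_within (top_of_set ?M) (A i)) \<and> (\<Union>i\<in>{1..n}. A i) = topspace (top_of_set ?M)}"
    then obtain n A where n: "c = enat n"
      and A: "\<forall>i\<in>{1..n}. closedin (top_of_set ?M) (A i) \<and> contractible_within (top_of_set ?M) (A i)"
      and cover: "(\<Union>i\<in>{1..n}. A i) = topspace (top_of_set ?M)"
      by (elim CollectE exE conjE)
    have "r < n" using bspec[OF A] cover[unfolded topspace_euclidean_subtopology] by (rule bound)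
    then show "enat (r + 1) \<le> c" by (simp add: n)
  qed
qed

theorem theorem1p13:
  fixes r :: nat and k :: "nat \<Rightarrow> nat"
  assumes "\<And>i. i \<in> {1..r} \<Longrightarrow> k i \<ge> 1"
  shows "ls_cat (product_topology (\<lambda>i. nsphere (k i)) {1..r}) = enat (r + 1)"
  using ls_cat_product_spheres_le[OF assms] product_spheres_le_ls_cat[OF assms] by (rule antisym)

end
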